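(* Let $G=(V,E)$ be a finite directed graph with nonnegative edge distances $d_e$ and losses $l_e$, source $s$ and destination $t$, and for an $s$-$t$ path $P$ let $d(P)=\sum_{e\in P}d_e$, $l(P)=\sum_{e\in P}l_e$, assumed to satisfy $d(P)>0$. Let $\kappa=\frac{20}{\ln 10}$ and $f(d,l)=l+\kappa\ln d$. Let $(d^*,l^* )$ be the distance-loss pair of a dominant $s$-$t$ path (an $s$-$t$ path minimizing $f(d(P),l(P))$), and let $\lambda^*=\kappa/d^*$. Let $\alpha>0$, $\lambda=\alpha\lambda^*$, and let $P_\lambda$ be any $s$-$t$ path minimizing $l(P)+\lambda d(P)$, with $(d_\lambda,l_\lambda)=(d(P_\lambda),l(P_\lambda))$. Then $$f(d_\lambda,l_\lambda)\le f(d^*,l^* )+\kappa\,(-1+\alpha-\ln\alpha).$$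
   Context: In the application (indoor dominant path model), $f$ is the modeled path loss in dB up to an additive constant, with $d$ Euclidean path length and $l$ total penetration plus diffraction loss; $\kappa\approx 8.686$ dB. *)

theory Defs
  imports Complex_Main "Graph_Theory.Graph_Theory"
begin

definition kappa :: real where
  "kappa = 20 / ln 10"

definition path_loss :: "real \<Rightarrow> real \<Rightarrow> real" where
  "path_loss d l = l + kappa * ln d"

abbreviation path_sum :: "('e \<Rightarrow> real) \<Rightarrow> 'e list \<Rightarrow> real" where
  "path_sum w P \<equiv> wf_digraph.awalk_cost w P"

definition dominant_path ::
  "('v, 'e) pre_digraph \<Rightarrow> ('e \<Rightarrow> real) \<Rightarrow> ('e \<Rightarrow> real) \<Rightarrow> 'v \<Rightarrow> 'v \<Rightarrow> 'e list \<Rightarrow> bool" where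
  "dominant_path G d l s t P \<longleftrightarrow>
     is_arg_min (\<lambda>Q. path_loss (path_sum d Q) (path_sum l Q))
       (\<lambda>Q. pre_digraph.apath G s Q t) P"

definition weighted_shortest_path ::
  "('v, 'e) pre_digraph \<Rightarrow> ('e \<Rightarrow> real) \<Rightarrow> ('e \<Rightarrow> real) \<Rightarrow> real \<Rightarrow> 'v \<Rightarrow> 'v \<Rightarrow> 'e list \<Rightarrow> bool" where
  "weighted_shortest_path G d l lam s t P \<longleftrightarrow>
     is_arg_min (\<lambda>Q. path_sum l Q + lam * path_sum d Q)
       (\<lambda>Q. pre_digraph.apath G s Q t) P"

end

theory Submission
  imports Defs
begin

text \<open>By concavity, \<open>kappa * ln d\<close> lies below its tangent at
  \<open>d_star / alpha\<close>, whose slope is exactly \<open>kappa * alpha / d_star = lam\<close>.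
  Hence \<open>path_loss d l\<close> is at most \<open>l + lam * d\<close> plus a constant.
  \<open>P_lam\<close> minimizes this linear majorant, so its value there is at most that of
  \<open>P_star\<close>. The error term is the gap between tangent and logarithm at
  \<open>d_star\<close>; it vanishes for \<open>alpha = 1\<close>.\<close>

theorem theorem3:
  fixes G :: "('v, 'e) pre_digraph"
    and d l :: "'e \<Rightarrow> real"
    and s t :: 'v
    and P_star P_lam :: "'e list"
    and d_star l_star lam_star alpha lam d_lam l_lam :: real
  assumes "fin_digraph G"
    and "s \<in> verts G" and "t \<in> verts G"
    and "\<And>e. e \<in> arcs G \<Longrightarrow> d e \<ge> 0"
    and "\<And>e. e \<in> arcs G \<Longrightarrow> l e \<ge> 0"
    and "\<And>P. pre_digraph.apath G s P t \<Longrightarrow> path_sum d P > 0"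
    and "dominant_path G d l s t P_star"
    and "d_star = path_sum d P_star" and "l_star = path_sum l P_star"
    and "lam_star = kappa / d_star"
    and "alpha > 0" and "lam = alpha * lam_star"
    and "weighted_shortest_path G d l lam s t P_lam"
    and "d_lam = path_sum d P_lam" and "l_lam = path_sum l P_lam"
  shows "path_loss d_lam l_lam \<le> path_loss d_star l_star + kappa * (- 1 + alpha - ln alpha)"
proof -
  have paths: "pre_digraph.apath G s P_star t" "pre_digraph.apath G s P_lam t"
    using assms(7,13)
    by (simp_all add: dominant_path_def weighted_shortest_path_def is_arg_min_linorder)
  then have d_star: "d_star > 0" and d_lam: "d_lam > 0"
    using assms(6,8,14) by simp_all
  \<comment> \<open>\<open>P_star\<close> is itself an admissible path, so it competes with
    \<open>P_lam\<close> in the weighted problem.\<close>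
  have "l_lam + lam * d_lam \<le> l_star + lam * d_star"
    using assms(8,9,13,14,15) paths(1)
    by (simp add: weighted_shortest_path_def is_arg_min_linorder)
  also have "lam * d_star = kappa * alpha"
    using d_star assms(10,12) by simp
  finally have optimal: "l_lam + lam * d_lam \<le> l_star + kappa * alpha" .
  \<comment> \<open>The tangent bound: \<open>ln x \<le> x - 1\<close>, with \<open>x\<close> the
    ratio of \<open>d_lam\<close> to the tangency point \<open>d_star / alpha\<close>.\<close>
  have "ln (alpha * d_lam / d_star) \<le> alpha * d_lam / d_star - 1"
    using d_star d_lam \<open>alpha > 0\<close> by (intro ln_le_minus_one) simp
  moreover have "ln (alpha * d_lam / d_star) = ln alpha + ln d_lam - ln d_star"
    using d_star d_lam \<open>alpha > 0\<close> by (simp add: ln_mult ln_div)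
  moreover have "kappa \<ge> 0"
    by (simp add: kappa_def)
  ultimately have
    "kappa * (ln alpha + ln d_lam - ln d_star) \<le> kappa * (alpha * d_lam / d_star - 1)"
    by (metis mult_left_mono)
  \<comment> \<open>The choice of \<open>lam\<close> makes the linear term the one in the weighted
    objective, so \<open>optimal\<close> can absorb it.\<close>
  also have "\<dots> = lam * d_lam - kappa"
    using assms(10,12) by (simp add: algebra_simps)
  finally show ?thesis
    using optimal by (simp add: path_loss_def algebra_simps)
qed

end
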